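(* For all $n\ge 3$, $\mathcal{F}_n$ is a proper subset of $\mathcal{A}_n$, where $\mathcal{F}_n=\{(x_1,\dots,x_n)\in\mathbb{R}^n : x_i\ge0\ \forall i,\ \sum_{i=1}^n x_i=1,\ x_1\ge x_2\ge\dots\ge x_n\}$ and $\mathcal{A}_n$ is the closure of the set of all win vectors $\boldsymbol{wv}(\boldsymbol{T},P)$ with $\boldsymbol{T}$ a symmetric and honest $n$-player tournament and $P\in\mathcal{D}_n$.
   Context: Write $[n]=\{1,\dots,n\}$ for the set of players. Let $\mathcal{M}_n=\{P=(p_{ij})\in[0,1]^{n\times n}: P+P^T=\mathbf{1}\}$, where $\mathbf{1}$ is the all-ones matrix (so $p_{ij}+p_{ji}=1$ and $p_{ii}=\frac12$). A matrix $P\in\mathcal{M}_n$ is doubly monotonic if $p_{ij}$ is (weakly) decreasing in $i$ and (weakly) increasing in $j$; $\mathcal{D}_n$ is the set of doubly monotonic $P\in\mathcal{M}_n$. An $n$-player tournament $\boldsymbol{T}$ is a set of rules (a randomized algorithm) which, one match at a time, announces an unordered pair $\{i,j\}$ of distinct players who then play a match, receives as only information which of the two won (no draws), and eventually announces one of the $n$ players as tournament winner. The choice of the next pair, and of the winner, may depend on the results of earlier matches and on additional randomness. The number of matches is bounded by a constant depending only on $\boldsymbol{T}$. For $P\in\mathcal{M}_n$, the specialization $(\boldsymbol{T},P)$ is the random process in which every match between $i$ and $j$ is won by $i$ with probability $p_{ij}$, independently of the past; $\pi_i(P)$ is the probability that player $i$ wins the tournament, and $\boldsymbol{wv}(\boldsymbol{T},P)=(\pi_1(P),\dots,\pi_n(P))$.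 Symmetric: for every $P\in\mathcal{M}_n$, every permutation $\sigma$ of $[n]$ and every $i\in[n]$, $\pi_i(P)=\pi_{\sigma(i)}(Q)$, where $Q\in\mathcal{M}_n$ is defined by $q_{\sigma(i)\sigma(j)}=p_{ij}$. Honest: for every possible state of $\boldsymbol{T}$ in which $r\ge0$ matches have been played and a pair $\{i,j\}$ has just been announced for match $r+1$ (the state includes the results of the previous matches and all random choices already made by the rules), and every $P\in\mathcal{M}_n$, one has $\pi_i^+(P)\ge\pi_i^-(P)$, where $\pi_i^+(P)$ (resp. $\pi_i^-(P)$) is the probability that $i$ wins the tournament conditioned on the current state and on $i$ winning (resp. losing) match $r+1$, with all subsequent matches decided according to $P$. *)

theory Defs
  imports "HOL-Probability.Probability"
begin

text \<open>
  Throughout, the player set \<open>[n]\<close> is rendered as a finite linearly ordered type \<open>'n\<close> with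
  \<open>n = CARD('n)\<close>; its order is the order of \<open>1, \<dots>, n\<close>.
\<close>

definition comparison_matrices :: "(real^'n^'n) set" where
  "comparison_matrices =
     {P. (\<forall>i j. P $ i $ j \<in> {0..1}) \<and> P + transpose P = (\<chi> i j. 1)}"

definition doubly_monotonic :: "(real^'n::{finite,linorder}^'n::{finite,linorder}) set" where
  "doubly_monotonic =
     {P \<in> comparison_matrices.
        (\<forall>i i' j. i \<le> i' \<longrightarrow> P $ i' $ j \<le> P $ i $ j) \<and>
        (\<forall>i j j'. j \<le> j' \<longrightarrow> P $ i $ j \<le> P $ i $ j')}"

text \<open>
  Rules are decision trees. \<open>Announce i j T U\<close> announces the pair \<open>{i, j}\<close> and continues with \<open>T\<close>
  if \<open>i\<close> wins and with \<open>U\<close> if \<open>j\<close> wins (so \<open>Announce j i U T\<close> describes the same behaviour).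
  \<open>Randomize D\<close> is a random choice made by the rules themselves: the continuation is drawn
  from \<open>D\<close>. A node reached in the tree is a state of the tournament: it fixes the results of all
  matches played and all random choices made so far.
\<close>

datatype 'a rules =
    Declare 'a
  | Announce 'a 'a "'a rules" "'a rules"
  | Randomize "'a rules pmf"

inductive state_of :: "'a rules \<Rightarrow> 'a rules \<Rightarrow> bool" for T :: "'a rules" where
  start: "state_of T T"
| first_wins: "state_of T (Announce i j U V) \<Longrightarrow> state_of T U"
| second_wins: "state_of T (Announce i j U V) \<Longrightarrow> state_of T V"
| random_choice: "state_of T (Randomize D) \<Longrightarrow> U \<in> set_pmf D \<Longrightarrow> state_of T U"

inductive at_most_matches :: "nat \<Rightarrow> 'a rules \<Rightarrow> bool" where
  "at_most_matches k (Declare i)"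
| "at_most_matches k U \<Longrightarrow> at_most_matches k V \<Longrightarrow> at_most_matches (Suc k) (Announce i j U V)"
| "(\<And>U. U \<in> set_pmf D \<Longrightarrow> at_most_matches k U) \<Longrightarrow> at_most_matches k (Randomize D)"

definition tournament :: "'a rules \<Rightarrow> bool" where
  "tournament T \<longleftrightarrow>
     (\<forall>i j U V. state_of T (Announce i j U V) \<longrightarrow> i \<noteq> j) \<and> (\<exists>k. at_most_matches k T)"

text \<open>
  The distribution of the tournament winner in the specialization to \<open>P\<close>, when the process is
  started in a given state.
\<close>

primrec winner :: "real^'n^'n \<Rightarrow> 'n rules \<Rightarrow> 'n pmf" where
  "winner P (Declare i) = return_pmf i"
| "winner P (Announce i j T U) =
     bind_pmf (bernoulli_pmf (P $ i $ j)) (\<lambda>i_wins. if i_wins then winner P T else winner P U)"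
| "winner P (Randomize D) = join_pmf (map_pmf (winner P) D)"

definition win_prob :: "'n rules \<Rightarrow> real^'n^'n \<Rightarrow> 'n \<Rightarrow> real" where
  "win_prob T P i = pmf (winner P T) i"

definition win_vector :: "'n::finite rules \<Rightarrow> real^'n^'n \<Rightarrow> real^'n" where
  "win_vector T P = (\<chi> i. win_prob T P i)"

definition symmetric :: "'n::finite rules \<Rightarrow> bool" where
  "symmetric T \<longleftrightarrow>
     (\<forall>P\<in>comparison_matrices. \<forall>\<sigma>. bij \<sigma> \<longrightarrow>
        (\<forall>Q\<in>comparison_matrices. (\<forall>i j. Q $ \<sigma> i $ \<sigma> j = P $ i $ j) \<longrightarrow>
           (\<forall>i. win_prob T P i = win_prob T Q (\<sigma> i))))"

text \<open>
  The pair announced is unordered, so the condition is imposed on both players of the match.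
  Conditioning on the current state and on the result of the announced match amounts to
  restarting the process in the successor state; this also gives a meaning to the condition for
  matrices \<open>P\<close> under which that state or that result has probability zero.
\<close>

definition honest :: "'n::finite rules \<Rightarrow> bool" where
  "honest T \<longleftrightarrow>
     (\<forall>i j U V. state_of T (Announce i j U V) \<longrightarrow>
        (\<forall>P\<in>comparison_matrices.
           win_prob U P i \<ge> win_prob V P i \<and> win_prob V P j \<ge> win_prob U P j))"

definition fair_vectors :: "(real^'n::{finite,linorder}) set" where
  "fair_vectors =
     {x. (\<forall>i. x $ i \<ge> 0) \<and> (\<Sum>i\<in>UNIV. x $ i) = 1 \<and> (\<forall>i j. i \<le> j \<longrightarrow> x $ i \<ge> x $ j)}"

definition achievable_vectors :: "(real^'n::{finite,linorder}) set" where
  "achievable_vectors =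
     closure {win_vector T P | T P.
        tournament T \<and> symmetric T \<and> honest T \<and> P \<in> doubly_monotonic}"

end

theory Submission imports Defs begin

text \<open>
  Relabelling the players of any honest tournament by a uniformly random permutation makes it
  symmetric and keeps it honest, so symmetry comes for free.

  A fair vector \<open>x\<close> is attained exactly: play a round robin, rank the players by score and let
  the player ranked \<open>r\<close> win with probability \<open>x\<^sub>r\<close>. Winning a match never worsens one's rank, and
  if the better player always wins then the ranking is the true one.

  For an unfair vector, let three players \<open>i, j, k\<close> be chosen at random and let \<open>j\<close> and \<open>k\<close> play
  twice. If the same player wins both matches, a coin decides between that player and \<open>i\<close>;
  otherwise \<open>i\<close> wins. This is honest, but \<open>i\<close> profits from a balanced pair \<open>j, k\<close>. Suppose the two
  weakest players \<open>a < b\<close> are equally strong against each other, \<open>b\<close> never beats a third player and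
  \<open>a\<close> does so with small probability \<open>\<epsilon>\<close>. As the bystander \<open>i\<close>, \<open>b\<close> gains order \<open>\<epsilon>\<close> over \<open>a\<close> since
  the matches of \<open>a\<close> are less one-sided than those of \<open>b\<close>, whereas by its own victories \<open>a\<close> gains
  only order \<open>\<epsilon>\<^sup>2\<close> over \<open>b\<close>.
\<close>

section \<open>States, honesty and win probabilities along the decision tree\<close>

lemma comparison_matrices_iff:
  "P \<in> comparison_matrices \<longleftrightarrow>
     (\<forall>i j. 0 \<le> P $ i $ j \<and> P $ i $ j \<le> 1 \<and> P $ i $ j + P $ j $ i = 1)"
  by (auto simp: comparison_matrices_def vec_eq_iff Finite_Cartesian_Product.transpose_def)

lemma state_of_Declare: "state_of (Declare i) X \<longleftrightarrow> X = Declare i"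
proof
  show "state_of (Declare i) X \<Longrightarrow> X = Declare i"
    by (induction rule: state_of.induct) auto
qed (auto intro: state_of.intros)

lemma state_of_trans: "state_of U X \<Longrightarrow> state_of T U \<Longrightarrow> state_of T X"
  by (induction rule: state_of.induct) (auto intro: state_of.intros)

lemma state_of_Announce:
  "state_of (Announce i j U V) X \<longleftrightarrow> X = Announce i j U V \<or> state_of U X \<or> state_of V X"
proof
  show "state_of (Announce i j U V) X \<Longrightarrow>
          X = Announce i j U V \<or> state_of U X \<or> state_of V X"
    by (induction rule: state_of.induct) (auto intro: state_of.intros)
qed (auto intro: state_of.start state_of_trans[OF _ state_of.first_wins[OF state_of.start]]
       state_of_trans[OF _ state_of.second_wins[OF state_of.start]])

lemma state_of_Randomize:
  "state_of (Randomize D) X \<longleftrightarrow> X = Randomize D \<or> (\<exists>U\<in>set_pmf D. state_of U X)"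
proof
  show "state_of (Randomize D) X \<Longrightarrow> X = Randomize D \<or> (\<exists>U\<in>set_pmf D. state_of U X)"
    by (induction rule: state_of.induct) (auto intro: state_of.intros)
qed (auto intro: state_of.start state_of_trans[OF _ state_of.random_choice[OF state_of.start]])

lemma state_of_map_rules:
  "state_of (map_rules f T) X \<Longrightarrow> \<exists>Y. X = map_rules f Y \<and> state_of T Y"
proof (induction rule: state_of.induct)
  case (first_wins i j U V)
  then obtain Y where "Announce i j U V = map_rules f Y" "state_of T Y" by blast
  then show ?case by (cases Y) (auto intro: state_of.intros)
next
  case (second_wins i j U V)
  then obtain Y where "Announce i j U V = map_rules f Y" "state_of T Y" by blast
  then show ?case by (cases Y) (auto intro: state_of.intros)
next
  case (random_choice D U)
  then obtain Y where "Randomize D = map_rules f Y" "state_of T Y" by blast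
  with random_choice.hyps show ?case by (cases Y) (auto intro: state_of.intros)
qed (auto intro: state_of.intros)

lemma at_most_matches_map_rules: "at_most_matches k T \<Longrightarrow> at_most_matches k (map_rules f T)"
  by (induction rule: at_most_matches.induct) (auto intro!: at_most_matches.intros)

lemma honest_Declare: "honest (Declare i)"
  by (simp add: honest_def state_of_Declare)

text \<open>An announcement is constrained only through its two continuations, so honesty can be
  verified by recursion over the tree.\<close>

lemma honest_Announce:
  "honest (Announce i j U V) \<longleftrightarrow> honest U \<and> honest V \<and>
     (\<forall>P\<in>comparison_matrices. win_prob U P i \<ge> win_prob V P i \<and> win_prob V P j \<ge> win_prob U P j)"
  unfolding honest_def state_of_Announce by blast

lemma honest_Randomize: "honest (Randomize D) \<longleftrightarrow> (\<forall>U\<in>set_pmf D. honest U)"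
  unfolding honest_def state_of_Randomize by blast

lemma win_prob_Declare: "win_prob (Declare i) P m = of_bool (m = i)"
  by (auto simp: win_prob_def pmf_return indicator_def)

lemma win_prob_Announce:
  assumes "P \<in> comparison_matrices"
  shows "win_prob (Announce i j U V) P m =
           P $ i $ j * win_prob U P m + (1 - P $ i $ j) * win_prob V P m"
  using assms by (simp add: win_prob_def pmf_bind comparison_matrices_iff)

lemma win_prob_Randomize_finite:
  assumes "finite A" "A \<noteq> {}"
  shows "win_prob (Randomize (map_pmf f (pmf_of_set A))) P m =
           (\<Sum>a\<in>A. win_prob (f a) P m) / card A"
  using assms
  by (simp add: win_prob_def map_pmf_comp join_pmf_def bind_map_pmf pmf_bind integral_pmf_of_set)

lemma winner_Randomize_Declare: "winner P (Randomize (map_pmf Declare D)) = D"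
  by (simp add: map_pmf_comp join_map_return_pmf)

section \<open>Symmetrization\<close>

text \<open>Relabelling rules and matrix together only renames the players of one and the same
  random process.\<close>

lemma winner_map_rules:
  assumes "\<And>i j. Q $ \<sigma> i $ \<sigma> j = P $ i $ j"
  shows "winner Q (map_rules \<sigma> T) = map_pmf \<sigma> (winner P T)"
proof (induction T)
  case (Randomize D)
  then show ?case
    by (simp add: map_pmf_comp join_pmf_def bind_map_pmf map_bind_pmf cong: bind_pmf_cong)
qed (auto simp: assms map_bind_pmf intro!: bind_pmf_cong)

lemma win_prob_map_rules:
  assumes "\<And>i j. Q $ \<sigma> i $ \<sigma> j = P $ i $ j" "bij \<sigma>"
  shows "win_prob (map_rules \<sigma> T) Q (\<sigma> i) = win_prob T P i"
  using assms(2) by (simp add: win_prob_def winner_map_rules[OF assms(1)] pmf_map_inj' bij_is_inj)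

definition symmetrize :: "'n::finite rules \<Rightarrow> 'n rules" where
  "symmetrize T = Randomize (map_pmf (\<lambda>\<sigma>. map_rules \<sigma> T) (pmf_of_set {\<sigma>. bij \<sigma>}))"

lemma win_prob_symmetrize:
  fixes T :: "'n::finite rules"
  shows "win_prob (symmetrize T) P m =
           (\<Sum>\<sigma> | bij \<sigma>. win_prob (map_rules \<sigma> T) P m) / card {\<sigma> :: 'n \<Rightarrow> 'n. bij \<sigma>}"
  unfolding symmetrize_def by (rule win_prob_Randomize_finite) (auto intro: bij_id)

text \<open>Left composition with \<open>\<tau>\<close> permutes the group of bijections. This gives
  the symmetry of \<open>symmetrize\<close> and later allows exchanging two players inside the
  average.\<close>

lemma sum_bij_comp:
  fixes \<tau> :: "'n::finite \<Rightarrow> 'n"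
  assumes "bij \<tau>"
  shows "(\<Sum>\<sigma> | bij \<sigma>. f (\<tau> \<circ> \<sigma>)) = (\<Sum>\<sigma> | bij \<sigma>. f \<sigma>)"
  by (rule sum.reindex_bij_witness[of _ "\<lambda>\<sigma>. inv \<tau> \<circ> \<sigma>" "\<lambda>\<sigma>. \<tau> \<circ> \<sigma>"])
     (use assms in \<open>auto simp: fun_eq_iff bij_is_inj bij_is_surj surj_f_inv_f
        intro!: bij_comp bij_imp_bij_inv\<close>)

lemma symmetric_symmetrize: "symmetric (symmetrize (T :: 'n::finite rules))"
  unfolding symmetric_def
proof (intro ballI allI impI)
  fix P Q :: "real^'n^'n" and \<tau> :: "'n \<Rightarrow> 'n" and i
  assume \<tau>: "bij \<tau>" and PQ: "\<forall>i j. Q $ \<tau> i $ \<tau> j = P $ i $ j"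
  have "win_prob (map_rules \<sigma> T) P i = win_prob (map_rules (\<tau> \<circ> \<sigma>) T) Q (\<tau> i)" for \<sigma>
    using win_prob_map_rules[of Q \<tau> P "map_rules \<sigma> T" i] \<tau> PQ by (simp add: rules.map_comp)
  then show "win_prob (symmetrize T) P i = win_prob (symmetrize T) Q (\<tau> i)"
    using sum_bij_comp[OF \<tau>, of "\<lambda>\<sigma>. win_prob (map_rules \<sigma> T) Q (\<tau> i)"]
    by (simp add: win_prob_symmetrize)
qed

text \<open>Every state of the relabelled rules is a relabelled state of \<open>T\<close>, and its
  win probabilities under \<open>Q\<close> are those of \<open>T\<close> under \<open>Q\<close>
  pulled back along \<open>\<sigma>\<close>.\<close>

lemma honest_map_rules:
  fixes T :: "'n::finite rules" and \<sigma> :: "'n \<Rightarrow> 'n"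
  assumes "honest T" "bij \<sigma>"
  shows "honest (map_rules \<sigma> T)"
  unfolding honest_def
proof (intro allI impI ballI)
  fix i j U V and Q :: "real^'n^'n"
  assume st: "state_of (map_rules \<sigma> T) (Announce i j U V)" and Q: "Q \<in> comparison_matrices"
  obtain Y where "Announce i j U V = map_rules \<sigma> Y" "state_of T Y"
    using state_of_map_rules[OF st] by blast
  then obtain i' j' U' V' where Y: "state_of T (Announce i' j' U' V')"
    "i = \<sigma> i'" "j = \<sigma> j'" "U = map_rules \<sigma> U'" "V = map_rules \<sigma> V'"
    by (cases Y) auto
  define P :: "real^'n^'n" where "P = (\<chi> i j. Q $ \<sigma> i $ \<sigma> j)"
  have "P \<in> comparison_matrices" using Q by (simp add: comparison_matrices_iff P_def)
  moreover have "win_prob (map_rules \<sigma> X) Q (\<sigma> m) = win_prob X P m" for X m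
    by (rule win_prob_map_rules) (simp_all add: P_def assms(2))
  ultimately show "win_prob V Q i \<le> win_prob U Q i \<and> win_prob U Q j \<le> win_prob V Q j"
    using assms(1) Y unfolding honest_def by auto
qed

lemma set_pmf_relabelings:
  fixes T :: "'n::finite rules"
  shows "set_pmf (map_pmf (\<lambda>\<sigma>. map_rules \<sigma> T) (pmf_of_set {\<sigma> :: 'n \<Rightarrow> 'n. bij \<sigma>})) =
           (\<lambda>\<sigma>. map_rules \<sigma> T) ` {\<sigma>. bij \<sigma>}"
  by (subst set_map_pmf, subst set_pmf_of_set) (auto intro: bij_id)

lemma honest_symmetrize: "honest T \<Longrightarrow> honest (symmetrize T)"
  unfolding symmetrize_def honest_Randomize set_pmf_relabelings by (auto intro: honest_map_rules)

lemma tournament_symmetrize: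
  fixes T :: "'n::finite rules"
  assumes "tournament T"
  shows "tournament (symmetrize T)"
proof -
  obtain k where "at_most_matches k T" using assms by (auto simp: tournament_def)
  then have "at_most_matches k (symmetrize T)"
    unfolding symmetrize_def
    by (auto intro!: at_most_matches.intros at_most_matches_map_rules
          simp: set_pmf_relabelings simp del: set_map_pmf)
  moreover have "i \<noteq> j" if st: "state_of (symmetrize T) (Announce i j U V)" for i j U V
  proof -
    obtain \<sigma> where \<sigma>: "bij \<sigma>" and st': "state_of (map_rules \<sigma> T) (Announce i j U V)"
      using st unfolding symmetrize_def state_of_Randomize set_pmf_relabelings by auto
    obtain Y where "Announce i j U V = map_rules \<sigma> Y" "state_of T Y"
      using state_of_map_rules[OF st'] by blast
    then show ?thesis using assms \<sigma>
      by (cases Y) (auto simp: tournament_def inj_eq bij_is_inj)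
  qed
  ultimately show ?thesis by (auto simp: tournament_def)
qed

lemma win_vector_symmetrize_achievable:
  assumes "tournament T" "honest T" "P \<in> doubly_monotonic"
  shows "win_vector (symmetrize T) P \<in> achievable_vectors"
  unfolding achievable_vectors_def
  using assms symmetric_symmetrize tournament_symmetrize honest_symmetrize
  by (intro subsetD[OF closure_subset]) blast

section \<open>Fair vectors are achievable\<close>

text \<open>In a strict linear order the number of predecessors grows strictly along the
  order.\<close>

lemma inj_card_below:
  fixes Q :: "'a::finite \<Rightarrow> 'a \<Rightarrow> bool"
  assumes "\<And>i j k. Q i j \<Longrightarrow> Q j k \<Longrightarrow> Q i k" "\<And>i. \<not> Q i i" "\<And>i j. i \<noteq> j \<Longrightarrow> Q i j \<or> Q j i"
  shows "inj (\<lambda>i. card {j. Q j i})"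
proof -
  have "card {l. Q l i} < card {l. Q l j}" if "Q i j" for i j
  proof (rule psubset_card_mono)
    show "{l. Q l i} \<subset> {l. Q l j}" using assms that by blast
  qed simp
  then show ?thesis using assms(3) by (force intro!: injI)
qed

text \<open>
  \<open>(i, j) \<in> R\<close> records that \<open>i\<close> won a match against \<open>j\<close>. Scores are compared first and ties are
  broken by the labels; \<open>place R i\<close> is the rank of \<open>i\<close>, itself expressed as an element of \<open>'n\<close>.
\<close>

definition ahead :: "('n::{finite,linorder} \<times> 'n) set \<Rightarrow> 'n \<Rightarrow> 'n \<Rightarrow> bool" where
  "ahead R j i \<longleftrightarrow> card (R `` {i}) < card (R `` {j}) \<or> card (R `` {j}) = card (R `` {i}) \<and> j < i"

definition place :: "('n::{finite,linorder} \<times> 'n) set \<Rightarrow> 'n \<Rightarrow> 'n" where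
  "place R i = inv_into UNIV (\<lambda>i. card {j. j < i}) (card {j. ahead R j i})"

lemma inj_card_less: "inj (\<lambda>i::'n::{finite,linorder}. card {j. j < i})"
  by (rule inj_card_below) auto

lemma inj_card_ahead: "inj (\<lambda>i. card {j. ahead R j i})"
  by (rule inj_card_below) (auto simp: ahead_def)

text \<open>Injectivity makes the predecessor counts in \<open>'n\<close> exhaust
  \<open>{..<CARD('n)}\<close>, so the inverse in \<open>place\<close> is only applied to values
  that are attained.\<close>

lemma card_less_place: "card {j. j < place R i} = card {j. ahead R j i}"
proof -
  have "card {j. j < i} < CARD('a)" for i :: 'a
    by (rule psubset_card_mono) auto
  then have "range (\<lambda>i::'a. card {j. j < i}) = {..<CARD('a)}"
    by (intro card_subset_eq) (auto simp: card_image inj_card_less)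
  moreover have "card {j. ahead R j i} < CARD('a)"
    by (rule psubset_card_mono) (auto simp: ahead_def)
  ultimately show ?thesis unfolding place_def
    by (intro f_inv_into_f[of _ "\<lambda>i. card {j. j < i}"]) auto
qed

lemma bij_place: "bij (place R)"
proof -
  have "inj (place R)"
  proof (rule injI)
    fix i j assume "place R i = place R j"
    then have "card {l. ahead R l i} = card {l. ahead R l j}"
      by (simp flip: card_less_place)
    then show "i = j" by (rule injD[OF inj_card_ahead])
  qed
  then show ?thesis using finite_UNIV_inj_surj[of "place R"] by (auto simp: bij_def)
qed

text \<open>From \<open>R\<close> to \<open>R'\<close> the score of \<open>i\<close> does not fall
  and no other score rises, so nobody new gets ahead of \<open>i\<close>.\<close>

lemma place_mono:
  assumes "R `` {i} \<subseteq> R' `` {i}" "\<And>j. j \<noteq> i \<Longrightarrow> R' `` {j} \<subseteq> R `` {j}"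
  shows "place R' i \<le> place R i"
proof (rule ccontr)
  assume "\<not> ?thesis"
  then have "{j. j < place R i} \<subseteq> {j. j < place R' i}" "place R i \<in> {j. j < place R' i} - {j. j < place R i}"
    by auto
  then have "{j. j < place R i} \<subset> {j. j < place R' i}" by blast
  then have "card {j. j < place R i} < card {j. j < place R' i}"
    by (simp add: psubset_card_mono)
  moreover have "card {j. ahead R' j i} \<le> card {j. ahead R j i}"
  proof (intro card_mono subsetI)
    have "card (R `` {i}) \<le> card (R' `` {i})" using assms(1) by (intro card_mono) auto
    moreover have "card (R' `` {j}) \<le> card (R `` {j})" if "j \<noteq> i" for j
      using assms(2)[OF that] by (intro card_mono) auto
    ultimately show "j \<in> {j. ahead R j i}" if "j \<in> {j. ahead R' j i}" for j
      using that by (cases "j = i") (force simp: ahead_def)+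
  qed auto
  ultimately show False by (simp add: card_less_place)
qed

text \<open>At the end \<open>X\<close> supplies a random rank, and \<open>inv (place R)\<close>
  converts it into the player holding that rank.\<close>

primrec round_robin ::
  "'n pmf \<Rightarrow> ('n::{finite,linorder} \<times> 'n) list \<Rightarrow> ('n \<times> 'n) set \<Rightarrow> 'n rules" where
  "round_robin X [] R = Randomize (map_pmf Declare (map_pmf (inv (place R)) X))"
| "round_robin X (m # ms) R = Announce (fst m) (snd m)
     (round_robin X ms (insert (fst m, snd m) R)) (round_robin X ms (insert (snd m, fst m) R))"

lemma win_prob_round_robin_Nil: "win_prob (round_robin X [] R) P i = pmf X (place R i)"
proof -
  have "pmf (map_pmf (inv (place R)) X) (inv (place R) (place R i)) = pmf X (place R i)"
    using bij_place by (intro pmf_map_inj') (auto intro: bij_imp_bij_inv bij_is_inj)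
  then show ?thesis
    unfolding win_prob_def round_robin.simps winner_Randomize_Declare
    by (simp add: bij_is_inj bij_place)
qed

text \<open>Adding the same result to both records preserves the hypotheses, which reduces the claim
  to \<open>place_mono\<close> after the last match. Honesty is the case where the records differ in
  a single result.\<close>

lemma win_prob_round_robin_mono:
  assumes "P \<in> comparison_matrices" "\<And>i j. i \<le> j \<Longrightarrow> pmf X j \<le> pmf X i"
  assumes "R `` {i} \<subseteq> R' `` {i}" "\<And>j. j \<noteq> i \<Longrightarrow> R' `` {j} \<subseteq> R `` {j}"
  shows "win_prob (round_robin X ms R) P i \<le> win_prob (round_robin X ms R') P i"
  using assms(3,4)
proof (induction ms arbitrary: R R')
  case Nil
  show ?case unfolding win_prob_round_robin_Nil using Nil by (intro assms(2) place_mono)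
next
  case (Cons m ms)
  have "win_prob (round_robin X ms (insert r R)) P i \<le> win_prob (round_robin X ms (insert r R')) P i"
    for r using Cons.prems by (intro Cons.IH) (cases r; fastforce)+
  then show ?case using assms(1)
    by (simp add: win_prob_Announce, simp add: comparison_matrices_iff add_mono mult_left_mono)
qed

lemma honest_round_robin:
  assumes "\<And>i j. i \<le> j \<Longrightarrow> pmf X j \<le> pmf X i" "\<forall>m\<in>set ms. fst m \<noteq> snd m"
  shows "honest (round_robin X ms R)"
  using assms(2)
proof (induction ms arbitrary: R)
  case Nil
  show ?case by (auto simp: honest_Randomize honest_Declare)
next
  case (Cons m ms)
  then show ?case
    by (cases m) (auto simp: honest_Announce intro!: win_prob_round_robin_mono assms(1))
qed

lemma tournament_round_robin:
  assumes "\<forall>m\<in>set ms. fst m \<noteq> snd m"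
  shows "tournament (round_robin X ms R)"
proof -
  have "at_most_matches (length ms) (round_robin X ms R)"
    by (induction ms arbitrary: R) (auto intro!: at_most_matches.intros)
  moreover have "i \<noteq> j" if "state_of (round_robin X ms R) (Announce i j U V)" for i j U V
    using assms that
    by (induction ms arbitrary: R) (auto simp: state_of_Announce state_of_Randomize state_of_Declare)
  ultimately show ?thesis by (auto simp: tournament_def)
qed

lemma win_prob_round_robin_deterministic:
  assumes "P \<in> comparison_matrices" "\<forall>(i, j)\<in>set ms. P $ i $ j \<in> {0, 1}"
  shows "win_prob (round_robin X ms R) P l =
    pmf X (place (R \<union> {(i, j). ((i, j) \<in> set ms \<or> (j, i) \<in> set ms) \<and> P $ i $ j = 1}) l)"
  using assms(2)
proof (induction ms arbitrary: R)
  case Nil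
  then show ?case using win_prob_round_robin_Nil[of X R P l] by simp
next
  case (Cons m ms)
  obtain a b where m: "m = (a, b)" by force
  have *: "P $ b $ a = 1 - P $ a $ b" using assms(1) by (simp add: comparison_matrices_iff algebra_simps)
  consider "P $ a $ b = 1" | "P $ a $ b = 0" using Cons.prems m by auto
  then show ?case
  proof cases
    case 1
    then have "win_prob (round_robin X (m # ms) R) P l = win_prob (round_robin X ms (insert (a, b) R)) P l"
      by (simp add: m win_prob_Announce assms(1))
    also have "\<dots> = pmf X (place (insert (a, b) R \<union>
        {(i, j). ((i, j) \<in> set ms \<or> (j, i) \<in> set ms) \<and> P $ i $ j = 1}) l)"
      using Cons.prems by (intro Cons.IH) auto
    also have "insert (a, b) R \<union> {(i, j). ((i, j) \<in> set ms \<or> (j, i) \<in> set ms) \<and> P $ i $ j = 1} =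
       R \<union> {(i, j). ((i, j) \<in> set (m # ms) \<or> (j, i) \<in> set (m # ms)) \<and> P $ i $ j = 1}"
      using 1 * by (auto simp: m)
    finally show ?thesis .
  next
    case 2
    then have "win_prob (round_robin X (m # ms) R) P l = win_prob (round_robin X ms (insert (b, a) R)) P l"
      by (simp add: m win_prob_Announce assms(1))
    also have "\<dots> = pmf X (place (insert (b, a) R \<union>
        {(i, j). ((i, j) \<in> set ms \<or> (j, i) \<in> set ms) \<and> P $ i $ j = 1}) l)"
      using Cons.prems by (intro Cons.IH) auto
    also have "insert (b, a) R \<union> {(i, j). ((i, j) \<in> set ms \<or> (j, i) \<in> set ms) \<and> P $ i $ j = 1} =
       R \<union> {(i, j). ((i, j) \<in> set (m # ms) \<or> (j, i) \<in> set (m # ms)) \<and> P $ i $ j = 1}"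
      using 2 * by (auto simp: m)
    finally show ?thesis .
  qed
qed

text \<open>The score of \<open>i\<close> is the number of values above \<open>\<rho> i\<close>.
  Scores are thus distinct and the tie-break never acts.\<close>

lemma place_linear:
  fixes \<rho> :: "'n::{finite,linorder} \<Rightarrow> 'n"
  assumes "bij \<rho>"
  shows "place {(i, j). \<rho> i < \<rho> j} l = \<rho> l"
proof -
  let ?R = "{(i, j). \<rho> i < \<rho> j}"
  have card_vimage: "card (\<rho> -` A) = card A" for A
    using assms by (intro card_vimage_inj) (auto simp: bij_def)
  have "?R `` {i} = \<rho> -` {j. \<rho> i < j}" for i by auto
  then have score: "card (?R `` {i}) = card {j. \<rho> i < j}" for i
    by (simp only: card_vimage)
  have less: "card {l. j < l} < card {l. i < l}" if "i < j" for i j :: 'n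
  proof (rule psubset_card_mono)
    have "{l. j < l} \<subseteq> {l. i < l}" "j \<in> {l. i < l} - {l. j < l}" using that by auto
    then show "{l. j < l} \<subset> {l. i < l}" by blast
  qed simp
  have "ahead ?R j l \<longleftrightarrow> \<rho> j < \<rho> l" for j
  proof (cases "j = l")
    case False
    then have "\<rho> j < \<rho> l \<or> \<rho> l < \<rho> j" using assms by (metis bij_is_inj injD linorder_neqE)
    then show ?thesis
      using less[of "\<rho> j" "\<rho> l"] less[of "\<rho> l" "\<rho> j"] unfolding ahead_def score by linarith
  qed (simp add: ahead_def)
  then have "{j. ahead ?R j l} = \<rho> -` {j. j < \<rho> l}" by auto
  then have "card {j. j < place ?R l} = card {j. j < \<rho> l}"
    unfolding card_less_place by (simp only: card_vimage)
  then show ?thesis by (rule injD[OF inj_card_less])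
qed

lemma fair_subset_achievable: "fair_vectors \<subseteq> achievable_vectors"
proof
  fix x :: "real^'n::{finite,linorder}" assume x: "x \<in> fair_vectors"
  define X where "X = embed_pmf (\<lambda>i. x $ i)"
  have X: "pmf X i = x $ i" for i
    unfolding X_def using x
    by (intro pmf_embed_pmf) (auto simp: fair_vectors_def nn_integral_count_space_finite)
  \<comment> \<open>Each pair occurs in both orders and so meets more than once. Repeated results do
    not alter the record, which is a set.\<close>
  obtain ms :: "('n \<times> 'n) list" where ms: "set ms = {(i, j). i \<noteq> j}"
    using finite_list[of "{(i :: 'n, j). i \<noteq> j}"] by auto
  define T where "T = round_robin X ms {}"
  define P :: "real^'n::{finite,linorder}^'n::{finite,linorder}" where "P = (\<chi> i j. if i < j then 1 else if i = j then 1/2 else 0)"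
  have P: "P \<in> doubly_monotonic" by (auto simp: doubly_monotonic_def comparison_matrices_iff P_def)
  have mono: "i \<le> j \<Longrightarrow> pmf X j \<le> pmf X i" for i j using x by (simp add: X fair_vectors_def)
  \<comment> \<open>Every single relabelling already yields \<open>x\<close>, hence so does their
    average.\<close>
  have "win_prob (map_rules \<sigma> T) P i = x $ i" if \<sigma>: "bij \<sigma>" for \<sigma> i
  proof -
    define Q :: "real^'n::{finite,linorder}^'n::{finite,linorder}" where "Q = (\<chi> i j. P $ \<sigma> i $ \<sigma> j)"
    \<comment> \<open>\<open>l\<close> is the player of \<open>T\<close> relabelled to
      \<open>i\<close>; under \<open>Q\<close> its place is \<open>\<sigma> l\<close>, which is
      \<open>i\<close>.\<close>
    define l where "l = inv \<sigma> i"
    have l: "\<sigma> l = i" using \<sigma> by (simp add: l_def bij_is_surj surj_f_inv_f)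
    have Q: "Q \<in> comparison_matrices" using P by (simp add: doubly_monotonic_def comparison_matrices_iff Q_def)
    have "win_prob (map_rules \<sigma> T) P i = win_prob T Q l"
      unfolding l[symmetric] using \<sigma> by (intro win_prob_map_rules) (simp_all add: Q_def)
    also have "\<dots> = pmf X (place ({} \<union> {(i, j). ((i, j) \<in> set ms \<or> (j, i) \<in> set ms) \<and> Q $ i $ j = 1}) l)"
      unfolding T_def using bij_is_inj[OF \<sigma>]
      by (intro win_prob_round_robin_deterministic[OF Q]) (auto simp: ms Q_def P_def dest: injD)
    also have "{} \<union> {(i, j). ((i, j) \<in> set ms \<or> (j, i) \<in> set ms) \<and> Q $ i $ j = 1} = {(i, j). \<sigma> i < \<sigma> j}"
      by (auto simp: ms Q_def P_def split: if_splits)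
    also have "place \<dots> l = i"
      using place_linear[OF \<sigma>] by (simp add: l)
    finally show ?thesis by (simp add: X)
  qed
  moreover have "card {\<sigma> :: 'n \<Rightarrow> 'n. bij \<sigma>} \<noteq> 0" by (auto intro: bij_id)
  ultimately have "win_prob (symmetrize T) P i = x $ i" for i
    by (simp add: win_prob_symmetrize)
  then have "win_vector (symmetrize T) P = x" by (simp add: win_vector_def vec_eq_iff)
  moreover have "tournament T" "honest T"
    unfolding T_def by (auto simp: ms intro!: tournament_round_robin honest_round_robin mono)
  ultimately show "x \<in> achievable_vectors"
    using win_vector_symmetrize_achievable[OF _ _ P, of T] by simp
qed

section \<open>An unfair achievable vector\<close>

definition coin :: "'n \<Rightarrow> 'n \<Rightarrow> 'n rules" where
  "coin i j = Randomize (map_pmf (\<lambda>b. if b then Declare i else Declare j) (bernoulli_pmf (1/2)))"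

definition two_matches :: "'n \<Rightarrow> 'n \<Rightarrow> 'n \<Rightarrow> 'n rules" where
  "two_matches i j k = Announce j k
     (Announce j k (coin j i) (Declare i)) (Announce j k (Declare i) (coin k i))"

lemma win_prob_coin: "win_prob (coin i j) P m = of_bool (m = i) / 2 + of_bool (m = j) / 2"
  by (auto simp: coin_def win_prob_def map_pmf_comp join_pmf_def bind_map_pmf pmf_bind pmf_return indicator_def)

text \<open>With p + q = 1, the bystander's share is 2pq + (p^2 + q^2)/2 = 1/2 + pq, which is
  largest for a balanced pair.\<close>

lemma win_prob_two_matches:
  assumes "P \<in> comparison_matrices"
  shows "win_prob (two_matches i j k) P m =
    of_bool (m = j) * (P $ j $ k)\<^sup>2 / 2 + of_bool (m = k) * (P $ k $ j)\<^sup>2 / 2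
    + of_bool (m = i) * (1/2 + P $ j $ k * P $ k $ j)"
proof -
  have *: "P $ k $ j = 1 - P $ j $ k" using assms by (simp add: comparison_matrices_iff algebra_simps)
  show ?thesis unfolding *
    by (simp add: two_matches_def win_prob_Announce[OF assms] win_prob_coin win_prob_Declare
          of_bool_def power2_eq_square field_simps)
qed

lemma map_rules_two_matches: "map_rules \<sigma> (two_matches i j k) = two_matches (\<sigma> i) (\<sigma> j) (\<sigma> k)"
  by (simp add: two_matches_def coin_def map_pmf_comp if_distrib[of "map_rules \<sigma>"] cong: if_cong)

lemma tournament_two_matches:
  assumes "j \<noteq> k"
  shows "tournament (two_matches i j k)"
proof -
  have "at_most_matches 0 (coin l m)" for l m :: 'a
    by (auto simp: coin_def intro!: at_most_matches.intros)
  then have "at_most_matches (Suc (Suc 0)) (two_matches i j k)"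
    unfolding two_matches_def by (intro at_most_matches.intros)
  then show ?thesis using assms
    by (auto simp: tournament_def two_matches_def coin_def state_of_Announce state_of_Randomize
          state_of_Declare split: if_splits)
qed

text \<open>\<open>j\<close> and \<open>k\<close> can win the tournament only by winning both
  matches, and \<open>i\<close> plays none.\<close>

lemma honest_two_matches:
  assumes "distinct [i, j, k]"
  shows "honest (two_matches i j k)"
proof -
  have "honest (coin l m)" for l m
    by (auto simp: coin_def honest_Randomize honest_Declare)
  then show ?thesis using assms
    by (auto simp: two_matches_def honest_Announce honest_Declare win_prob_Announce win_prob_coin
          win_prob_Declare comparison_matrices_iff)
qed

definition unfair_matrix :: "real \<Rightarrow> 'n \<Rightarrow> 'n \<Rightarrow> real^'n^'n::finite" where
  "unfair_matrix \<epsilon> a b = (\<chi> i j.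
     if i \<in> {a, b} \<longleftrightarrow> j \<in> {a, b} then 1/2
     else if i = a then \<epsilon> else if j = a then 1 - \<epsilon> else if i = b then 0 else 1)"

lemma unfair_matrix_comparison:
  "0 \<le> \<epsilon> \<Longrightarrow> \<epsilon> \<le> 1 \<Longrightarrow> unfair_matrix \<epsilon> a b \<in> comparison_matrices"
  by (auto simp: comparison_matrices_iff unfair_matrix_def)

lemma unfair_matrix_doubly_monotonic:
  fixes a b :: "'n::{finite,linorder}"
  assumes "0 \<le> \<epsilon>" "\<epsilon> \<le> 1/2" "a < b" "\<And>i. i \<noteq> a \<Longrightarrow> i \<noteq> b \<Longrightarrow> i < a"
  shows "unfair_matrix \<epsilon> a b \<in> doubly_monotonic"
proof -
  \<comment> \<open>The order has three levels: the other players, then \<open>a\<close>, then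
    \<open>b\<close>. Entries need only be compared across these levels.\<close>
  have le: "i = i' \<or> i' = b \<or> (i' = a \<and> i \<noteq> b) \<or> (i \<noteq> a \<and> i \<noteq> b)" if "i \<le> i'" for i i'
    using assms(3) assms(4)[of i'] assms(4)[of i] that by force
  show ?thesis
    unfolding doubly_monotonic_def
    using assms(1-3) le unfair_matrix_comparison[of \<epsilon> a b]
    by (auto simp: unfair_matrix_def; force)
qed

text \<open>
  Pairing each labelling \<open>(x, y, z)\<close> with the one where \<open>a\<close> and \<open>b\<close> are exchanged compares the two
  players in the same role; only the labellings with \<open>a\<close> as bystander and \<open>b\<close> playing are far from \<open>0\<close>.
\<close>

lemma exchange_bound:
  assumes "0 \<le> \<epsilon>" "\<epsilon> \<le> 1/2" "distinct [x, y, z]" "a \<noteq> b"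
  defines "\<tau> \<equiv> Transposition.transpose a b" and "P \<equiv> unfair_matrix \<epsilon> a b"
  shows "win_prob (two_matches (\<tau> x) (\<tau> y) (\<tau> z)) P b - win_prob (two_matches x y z) P a
           \<ge> - (\<epsilon>\<^sup>2 / 2)"
proof -
  have P: "P \<in> comparison_matrices"
    unfolding P_def using assms(1,2) by (intro unfair_matrix_comparison) auto
  \<comment> \<open>The difference is \<open>\<epsilon> * (1 - \<epsilon>)\<close> if
    \<open>a\<close> is bystander while \<open>b\<close> plays,
    \<open>- (\<epsilon>\<^sup>2 / 2)\<close> if \<open>a\<close> plays a third player, and 0
    otherwise. Both orders of the product arise from the two orders of the pair.\<close>
  have "\<epsilon>\<^sup>2 \<le> \<epsilon>" using assms(1,2) by (simp add: power2_eq_square mult_left_le)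
  then have "- (\<epsilon>\<^sup>2 / 2) \<le> \<epsilon> * (1 - \<epsilon>)" "- (\<epsilon>\<^sup>2 / 2) \<le> (1 - \<epsilon>) * \<epsilon>"
    using assms(1) by (simp_all add: algebra_simps power2_eq_square)
  then show ?thesis
    using assms(1,3,4) unfolding win_prob_two_matches[OF P] unfolding \<tau>_def P_def
    by (auto simp: unfair_matrix_def Transposition.transpose_def)
qed

lemma unfair_achievable:
  assumes "CARD('n::{finite,linorder}) \<ge> 3"
  shows "\<exists>v\<in>achievable_vectors. \<exists>a b :: 'n. a \<le> b \<and> v $ a < v $ b"
proof -
  define b :: 'n where "b = Max UNIV"
  define a :: 'n where "a = Max (UNIV - {b})"
  have ne: "UNIV - {b} \<noteq> {}" "UNIV - {a, b} \<noteq> {}"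
    using assms card_mono[of "{b}" UNIV] card_mono[of "{a, b}" UNIV] card_insert_le_m1[of 2 "{b}" a]
    by auto
  then obtain c where c: "c \<noteq> a" "c \<noteq> b" by auto
  have "a \<noteq> b" using Max_in[of "UNIV - {b}"] ne(1) unfolding a_def by auto
  then have ab: "a < b" unfolding b_def by (simp add: order.strict_iff_order)
  have below: "i < a" if "i \<noteq> a" "i \<noteq> b" for i
    using that Max_ge[of "UNIV - {b}" i] by (simp add: a_def order.strict_iff_order)
  define N where "N = real (card {\<sigma> :: 'n \<Rightarrow> 'n. bij \<sigma>})"
  have N: "N \<ge> 1" unfolding N_def using card_gt_0_iff[of "{\<sigma> :: 'n \<Rightarrow> 'n. bij \<sigma>}"] bij_id
    by (auto simp: Suc_le_eq)
  \<comment> \<open>One labelling gains \<open>\<epsilon> * (1 - \<epsilon>)\<close> and each of the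
    others loses at most \<open>\<epsilon>\<^sup>2 / 2\<close>; the gain prevails once
    \<open>N * \<epsilon> < 1\<close> and \<open>\<epsilon> \<le> 1/2\<close>.\<close>
  define \<epsilon> where "\<epsilon> = 1 / (N + 1)"
  have \<epsilon>: "0 < \<epsilon>" "\<epsilon> \<le> 1/2" "N * \<epsilon> < 1" using N by (auto simp: \<epsilon>_def field_simps)
  define P where "P = unfair_matrix \<epsilon> a b"
  have P: "P \<in> doubly_monotonic"
    unfolding P_def using \<epsilon> ab below by (intro unfair_matrix_doubly_monotonic) auto
  then have Pc: "P \<in> comparison_matrices" by (simp add: doubly_monotonic_def)
  define T where "T = two_matches a b c"
  define \<tau> where "\<tau> = Transposition.transpose a b"
  define d where "d \<sigma> = win_prob (map_rules (\<tau> \<circ> \<sigma>) T) P b - win_prob (map_rules \<sigma> T) P a" for \<sigma>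
  have d: "d \<sigma> \<ge> - (\<epsilon>\<^sup>2 / 2)" if "bij \<sigma>" for \<sigma>
    using exchange_bound[of \<epsilon> "\<sigma> a" "\<sigma> b" "\<sigma> c" a b] \<epsilon> ab c that
    by (simp add: d_def T_def map_rules_two_matches \<tau>_def P_def inj_eq bij_is_inj)
  \<comment> \<open>Under the identity \<open>a\<close> is the bystander and \<open>b\<close> plays
    \<open>c\<close>, the favourable case.\<close>
  have d_id: "d id = \<epsilon> * (1 - \<epsilon>)"
    using ab c by (simp add: d_def T_def map_rules_two_matches \<tau>_def win_prob_two_matches[OF Pc])
      (simp add: P_def unfair_matrix_def)
  have "0 < \<epsilon> * (1 - \<epsilon>) - N * (\<epsilon>\<^sup>2 / 2)"
  proof -
    have "N * \<epsilon> / 2 + \<epsilon> < 1" using \<epsilon> by linarith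
    then have "0 < \<epsilon> * (1 - \<epsilon> - N * \<epsilon> / 2)" using \<epsilon>(1) by (intro mult_pos_pos) linarith+
    then show ?thesis by (simp add: algebra_simps power2_eq_square)
  qed
  also have "\<dots> \<le> d id - (N - 1) * (\<epsilon>\<^sup>2 / 2)" unfolding d_id by (simp add: algebra_simps)
  also have "\<dots> = d id + (\<Sum>\<sigma>\<in>{\<sigma> :: 'n \<Rightarrow> 'n. bij \<sigma>} - {id}. - (\<epsilon>\<^sup>2 / 2))"
    using N by (simp add: N_def card_Diff_singleton of_nat_diff algebra_simps)
  also have "\<dots> \<le> d id + (\<Sum>\<sigma>\<in>{\<sigma>. bij \<sigma>} - {id}. d \<sigma>)"
    by (intro add_left_mono sum_mono d) auto
  also have "\<dots> = (\<Sum>\<sigma> | bij \<sigma>. d \<sigma>)" by (subst sum.remove[of _ id]) auto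
  \<comment> \<open>Composition with \<open>\<tau>\<close> permutes the labellings, so the exchanged
    terms add up to the full sum for \<open>b\<close>.\<close>
  also have "\<dots> = N * (win_prob (symmetrize T) P b - win_prob (symmetrize T) P a)"
    using N sum_bij_comp[of \<tau> "\<lambda>\<sigma>. win_prob (map_rules \<sigma> T) P b"]
    by (simp add: d_def sum_subtractf \<tau>_def win_prob_symmetrize flip: diff_divide_distrib N_def)
  finally have "win_prob (symmetrize T) P a < win_prob (symmetrize T) P b"
    using N by (simp add: zero_less_mult_iff)
  moreover have "win_vector (symmetrize T) P \<in> achievable_vectors"
    using ab c P unfolding T_def
    by (intro win_vector_symmetrize_achievable tournament_two_matches honest_two_matches) auto
  ultimately show ?thesis using ab by (intro bexI[of _ "win_vector (symmetrize T) P"] exI[of _ a] exI[of _ b])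
    (auto simp: win_vector_def)
qed

theorem corollary4p4:
  assumes "CARD('n::{finite,linorder}) \<ge> 3"
  shows "(fair_vectors :: (real^'n::{finite,linorder}) set) \<subset> achievable_vectors"
proof -
  obtain v :: "real^'n::{finite,linorder}" and a b where "v \<in> achievable_vectors" "a \<le> b" "v $ a < v $ b"
    using unfair_achievable[OF assms] by blast
  moreover from this have "v \<notin> fair_vectors" by (force simp: fair_vectors_def)
  ultimately show ?thesis using fair_subset_achievable by blast
qed

end
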